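(* In the algebraic decision-tree model, exact computation of the continuous integral $R_2$ indicator in two objectives, i.e. computing $R_2(P)$ from an (unordered) input of $n$ points $P\subset\mathbb{R}^2_{>0}$, requires $\Omega(n\log n)$ time in the worst case. The lower bound holds even for inputs all of whose points lie on the reciprocal-diagonal curve $\{(1/s,1/(1-s)):s\in(0,1)\}$.
   Context: For finite nonempty $P\subset\mathbb{R}^2_{>0}$, the two-objective integral $R_2$ value is $R_2(P)=\int_0^1\min_{p\in P}\max\{\lambda p_1,(1-\lambda)p_2\}\,d\lambda$. The algebraic decision-tree model is the standard model (Ben-Or) in which real inputs are processed by arithmetic operations and sign tests of the computed values, and the cost is the depth of the tree. *)

theory Defs
  imports "HOL-Analysis.Analysis"
begin

definition R2 :: "(real \<times> real) set \<Rightarrow> real" where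
  "R2 P = integral {0..1} (\<lambda>l. MIN p\<in>P. max (l * fst p) ((1 - l) * snd p))"

definition positive_quadrant :: "(real \<times> real) set" where
  "positive_quadrant = {p. 0 < fst p \<and> 0 < snd p}"

definition reciprocal_diagonal :: "(real \<times> real) set" where
  "reciprocal_diagonal = (\<lambda>s. (1 / s, 1 / (1 - s))) ` {0<..<1}"

datatype arith_op = Plus | Minus | Times | Divide

datatype operand = Constant real | Register nat

text \<open>
  The registers hold the real inputs followed by the values computed so far on the current path;
  a \<open>Compute\<close> node appends its result as a new register. The three subtrees of a \<open>Sign_Test\<close> node
  are followed when the tested value is negative, zero and positive, respectively.
\<close>

datatype alg_tree =
    Output operand
  | Compute arith_op operand operand alg_tree
  | Sign_Test operand alg_tree alg_tree alg_tree

fun operand_val :: "real list \<Rightarrow> operand \<Rightarrow> real option" where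
  "operand_val rs (Constant c) = Some c"
| "operand_val rs (Register i) = (if i < length rs then Some (rs ! i) else None)"

text \<open>Division by zero is undefined here, unlike the total division of the library.\<close>

fun arith_val :: "arith_op \<Rightarrow> real \<Rightarrow> real \<Rightarrow> real option" where
  "arith_val Plus a b = Some (a + b)"
| "arith_val Minus a b = Some (a - b)"
| "arith_val Times a b = Some (a * b)"
| "arith_val Divide a b = (if b = 0 then None else Some (a / b))"

fun run :: "alg_tree \<Rightarrow> real list \<Rightarrow> real option" where
  "run (Output a) rs = operand_val rs a"
| "run (Compute f a b t) rs =
    Option.bind (operand_val rs a) (\<lambda>x.
    Option.bind (operand_val rs b) (\<lambda>y.
    Option.bind (arith_val f x y) (\<lambda>z. run t (rs @ [z]))))"
| "run (Sign_Test a t_neg t_zero t_pos) rs =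
    Option.bind (operand_val rs a) (\<lambda>x.
      if x < 0 then run t_neg rs else if x = 0 then run t_zero rs else run t_pos rs)"

fun depth :: "alg_tree \<Rightarrow> nat" where
  "depth (Output a) = 0"
| "depth (Compute f a b t) = Suc (depth t)"
| "depth (Sign_Test a t_neg t_zero t_pos) =
    Suc (max (depth t_neg) (max (depth t_zero) (depth t_pos)))"

definition coordinates :: "(real \<times> real) list \<Rightarrow> real list" where
  "coordinates ps = concat (map (\<lambda>p. [fst p, snd p]) ps)"

text \<open>
  The input set is unordered: the tree must be correct for every enumeration \<open>ps\<close> of every set of
  \<open>n\<close> points of \<open>D\<close>.
\<close>

definition computes_R2 :: "(real \<times> real) set \<Rightarrow> nat \<Rightarrow> alg_tree \<Rightarrow> bool" where
  "computes_R2 D n t \<longleftrightarrow>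
    (\<forall>ps. length ps = n \<and> distinct ps \<and> set ps \<subseteq> D \<longrightarrow>
          run t (coordinates ps) = Some (R2 (set ps)))"

text \<open>This uniform form implies \<open>(\<lambda>n. real (depth (T n))) \<in> \<Omega>(g)\<close> (for nonnegative \<open>g\<close>)
  for every family \<open>T\<close> of correct trees.\<close>

definition R2_requires_Omega :: "(real \<times> real) set \<Rightarrow> (nat \<Rightarrow> real) \<Rightarrow> bool" where
  "R2_requires_Omega D g \<longleftrightarrow>
    (\<exists>c>0. \<forall>\<^sub>F n in sequentially. \<forall>t. computes_R2 D n t \<longrightarrow> c * g n \<le> real (depth t))"

end

theory Submission
  imports Defs "HOL-Computational_Algebra.Polynomial" "HOL-Combinatorics.Multiset_Permutations"
begin

text \<open>
  For points on the reciprocal diagonal with sorted parameters \<open>s\<^sub>1 < \<dots> < s\<^sub>n\<close>, and with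
  \<open>s\<^sub>0 = 0\<close>, \<open>s\<^sub>n\<^sub>+\<^sub>1 = 1\<close>, the indicator is the sum of \<open>g (s\<^sub>i\<^sub>+\<^sub>1 - s\<^sub>i)\<close> where
  \<open>g y = 1 / (2 (1 - y)) - (1 - y) / 2\<close>. The pole of \<open>g\<close> at 1 lets one read off which parameters are
  neighbours, so the \<open>n!\<close> orderings of the input lead to \<open>n!\<close> different rational functions. A tree
  computes a single rational function along each branch, and on an open set of inputs only the
  negative and positive outcomes of a nontrivial sign test matter; hence \<open>n! \<le> 2 ^ depth\<close>.
\<close>

section \<open>Rational functions of several variables\<close>

text \<open>
  A semantic stand-in for polynomials in several variables: continuity and polynomial restrictions
  to all lines suffice for the identity principle below.
\<close>

definition line_polynomial :: "(('i \<Rightarrow> real) \<Rightarrow> real) \<Rightarrow> bool" where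
  "line_polynomial P \<longleftrightarrow> continuous_on UNIV P \<and>
     (\<forall>x v. \<exists>p. \<forall>t. P (\<lambda>i. x i + t * v i) = poly p t)"

lemma line_polynomial_const [simp]: "line_polynomial (\<lambda>_. c)"
  unfolding line_polynomial_def by (auto intro: exI[of _ "[:c:]"])

lemma line_polynomial_coord [simp]: "line_polynomial (\<lambda>x. x i)"
proof -
  have "\<exists>p. \<forall>t. x i + t * v i = poly p t" for x v :: "'a \<Rightarrow> real"
    by (intro exI[of _ "[:x i, v i:]"]) simp
  thus ?thesis
    unfolding line_polynomial_def by (auto intro!: continuous_on_product_coordinates)
qed

lemma line_polynomial_add:
  assumes "line_polynomial P" "line_polynomial Q"
  shows "line_polynomial (\<lambda>x. P x + Q x)"
  using assms unfolding line_polynomial_def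
  by (auto intro!: continuous_on_add) (metis poly_add)

lemma line_polynomial_mult:
  assumes "line_polynomial P" "line_polynomial Q"
  shows "line_polynomial (\<lambda>x. P x * Q x)"
  using assms unfolding line_polynomial_def
  by (auto intro!: continuous_on_mult) (metis poly_mult)

lemma line_polynomial_diff:
  assumes "line_polynomial P" "line_polynomial Q"
  shows "line_polynomial (\<lambda>x. P x - Q x)"
  using assms unfolding line_polynomial_def
  by (auto intro!: continuous_on_diff) (metis poly_diff)

text \<open>On the line from \<open>x\<close> to \<open>z\<close> the function is a univariate
  polynomial. The parameters that land in \<open>V\<close> form a nonempty open set, hence an
  infinite one, so this polynomial is zero; parameter 1 gives \<open>z\<close>.\<close>

lemma line_polynomial_eq_0:
  assumes P: "line_polynomial P" and V: "open V" "x \<in> V" and zero: "\<And>y. y \<in> V \<Longrightarrow> P y = 0"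
  shows "P z = 0"
proof -
  define l where "l t = (\<lambda>i. x i + t * (z i - x i))" for t
  obtain p where p: "\<And>t. P (l t) = poly p t"
    using P unfolding line_polynomial_def l_def by metis
  have "continuous_on UNIV l"
    unfolding l_def by (intro continuous_on_coordinatewise_then_product continuous_intros)
  hence "open (l -` V)"
    using V(1) by (simp add: open_vimage)
  moreover have "0 \<in> l -` V"
    using V(2) by (simp add: l_def)
  ultimately have "infinite (l -` V)"
    using finite_imp_not_open by blast
  moreover have "l -` V \<subseteq> {t. poly p t = 0}"
    using zero p by force
  ultimately have "p = 0"
    using finite_subset poly_roots_finite by blast
  moreover have "l 1 = z"
    by (simp add: l_def)
  ultimately show ?thesis
    using p[of 1] by simp
qed

text \<open>A single quotient serves the whole of \<open>U\<close>, so an identity found in one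
  region carries over to any other, even when \<open>U\<close> is disconnected.\<close>

definition rational_on :: "('i \<Rightarrow> real) set \<Rightarrow> (('i \<Rightarrow> real) \<Rightarrow> real) \<Rightarrow> bool" where
  "rational_on U r \<longleftrightarrow> (\<exists>N D. line_polynomial N \<and> line_polynomial D \<and>
     (\<forall>x\<in>U. D x \<noteq> 0 \<and> r x = N x / D x))"

lemma rational_onE:
  assumes "rational_on U r"
  obtains N D where "line_polynomial N" "line_polynomial D"
    "\<And>x. x \<in> U \<Longrightarrow> D x \<noteq> 0" "\<And>x. x \<in> U \<Longrightarrow> r x = N x / D x"
  using assms unfolding rational_on_def by blast

lemma rational_on_subset: "rational_on U r \<Longrightarrow> V \<subseteq> U \<Longrightarrow> rational_on V r"
  unfolding rational_on_def by blast

lemma rational_on_polynomial: "line_polynomial P \<Longrightarrow> rational_on U P"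
  unfolding rational_on_def by (intro exI[of _ P] exI[of _ "\<lambda>_. 1"]) auto

lemma rational_on_add:
  assumes "rational_on U r" "rational_on U s"
  shows "rational_on U (\<lambda>x. r x + s x)"
proof -
  obtain N D where r: "line_polynomial N" "line_polynomial D"
    "\<And>x. x \<in> U \<Longrightarrow> D x \<noteq> 0" "\<And>x. x \<in> U \<Longrightarrow> r x = N x / D x"
    using assms(1) by (rule rational_onE) blast
  obtain M E where s: "line_polynomial M" "line_polynomial E"
    "\<And>x. x \<in> U \<Longrightarrow> E x \<noteq> 0" "\<And>x. x \<in> U \<Longrightarrow> s x = M x / E x"
    using assms(2) by (rule rational_onE) blast
  show ?thesis
    unfolding rational_on_def
    by (intro exI[of _ "\<lambda>x. N x * E x + M x * D x"] exI[of _ "\<lambda>x. D x * E x"])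
      (auto simp: r s add_frac_eq intro!: line_polynomial_add line_polynomial_mult)
qed

lemma rational_on_mult:
  assumes "rational_on U r" "rational_on U s"
  shows "rational_on U (\<lambda>x. r x * s x)"
proof -
  obtain N D where r: "line_polynomial N" "line_polynomial D"
    "\<And>x. x \<in> U \<Longrightarrow> D x \<noteq> 0" "\<And>x. x \<in> U \<Longrightarrow> r x = N x / D x"
    using assms(1) by (rule rational_onE) blast
  obtain M E where s: "line_polynomial M" "line_polynomial E"
    "\<And>x. x \<in> U \<Longrightarrow> E x \<noteq> 0" "\<And>x. x \<in> U \<Longrightarrow> s x = M x / E x"
    using assms(2) by (rule rational_onE) blast
  show ?thesis
    unfolding rational_on_def
    by (intro exI[of _ "\<lambda>x. N x * M x"] exI[of _ "\<lambda>x. D x * E x"])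
      (auto simp: r s intro!: line_polynomial_mult)
qed

lemma rational_on_inverse:
  assumes "rational_on U r" "\<And>x. x \<in> U \<Longrightarrow> r x \<noteq> 0"
  shows "rational_on U (\<lambda>x. 1 / r x)"
proof -
  obtain N D where r: "line_polynomial N" "line_polynomial D"
    "\<And>x. x \<in> U \<Longrightarrow> D x \<noteq> 0" "\<And>x. x \<in> U \<Longrightarrow> r x = N x / D x"
    using assms(1) by (rule rational_onE) blast
  show ?thesis
    unfolding rational_on_def using assms(2)
    by (intro exI[of _ D] exI[of _ N]) (auto simp: r)
qed

lemma rational_on_diff:
  assumes "rational_on U r" "rational_on U s"
  shows "rational_on U (\<lambda>x. r x - s x)"
  using rational_on_add[OF assms(1)
      rational_on_mult[OF rational_on_polynomial[OF line_polynomial_const[of "-1"]] assms(2)]]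
  by simp

lemma rational_on_divide:
  assumes "rational_on U r" "rational_on U s" "\<And>x. x \<in> U \<Longrightarrow> s x \<noteq> 0"
  shows "rational_on U (\<lambda>x. r x / s x)"
  using rational_on_mult[OF assms(1) rational_on_inverse[OF assms(2,3)]] by simp

lemma rational_on_sum:
  assumes "\<And>e. e \<in> E \<Longrightarrow> rational_on U (r e)"
  shows "rational_on U (\<lambda>x. \<Sum>e\<in>E. r e x)"
  using assms
  by (induction E rule: infinite_finite_induct)
    (auto intro: rational_on_add rational_on_polynomial)

text \<open>Cross-multiplying turns the equation into the vanishing of one polynomial on
  \<open>V\<close>, and this spreads to the whole space. The denominators do not vanish on
  \<open>U\<close>, so the fractions agree there.\<close>

lemma rational_on_identity:
  assumes "rational_on U r" "rational_on U s"
    and V: "open V" "V \<noteq> {}" "V \<subseteq> U" and eq: "\<And>x. x \<in> V \<Longrightarrow> r x = s x" and x: "x \<in> U"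
  shows "r x = s x"
proof -
  obtain N D where r: "line_polynomial N" "line_polynomial D"
    "\<And>x. x \<in> U \<Longrightarrow> D x \<noteq> 0" "\<And>x. x \<in> U \<Longrightarrow> r x = N x / D x"
    using assms(1) by (rule rational_onE) blast
  obtain M E where s: "line_polynomial M" "line_polynomial E"
    "\<And>x. x \<in> U \<Longrightarrow> E x \<noteq> 0" "\<And>x. x \<in> U \<Longrightarrow> s x = M x / E x"
    using assms(2) by (rule rational_onE) blast
  obtain z where z: "z \<in> V"
    using V(2) by blast
  have "N y * E y - M y * D y = 0" if "y \<in> V" for y
    using that V(3) eq[OF that] r(3,4) s(3,4) by (auto simp: subset_iff frac_eq_eq)
  hence "N x * E x - M x * D x = 0"
    using line_polynomial_eq_0[OF line_polynomial_diff[OF line_polynomial_mult[OF r(1) s(2)]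
          line_polynomial_mult[OF s(1) r(2)]] V(1) z] by blast
  thus ?thesis
    using r(3,4)[OF x] s(3,4)[OF x] by (simp add: frac_eq_eq)
qed

section \<open>Algebraic trees and families of rational functions\<close>

text \<open>Whether a register exists depends only on the length of \<open>rs\<close>, so
  definedness at the single point \<open>z\<close> settles all points.\<close>

lemma operand_rational:
  assumes "\<forall>r\<in>set rs. rational_on U r" "z \<in> U"
    and "operand_val (map (\<lambda>r. r z) rs) a \<noteq> None"
  obtains q where "rational_on U q"
    "\<And>x. operand_val (map (\<lambda>r. r x) rs) a = Some (q x)"
proof (cases a)
  case (Constant c)
  show ?thesis
    by (rule that[of "\<lambda>_. c"]) (simp_all add: Constant rational_on_polynomial)
next
  case (Register i)
  hence "i < length rs"
    using assms(3) by (auto split: if_splits)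
  thus ?thesis
    using that[of "rs ! i"] assms(1) Register by simp
qed

lemma arith_rational:
  assumes "rational_on U q" "rational_on U r"
    and "\<And>x. x \<in> U \<Longrightarrow> arith_val op (q x) (r x) \<noteq> None"
  obtains s where "rational_on U s" "\<And>x. x \<in> U \<Longrightarrow> arith_val op (q x) (r x) = Some (s x)"
proof (cases op)
  case Plus
  thus ?thesis using that[OF rational_on_add[OF assms(1,2)]] by simp
next
  case Minus
  thus ?thesis using that[OF rational_on_diff[OF assms(1,2)]] by simp
next
  case Times
  thus ?thesis using that[OF rational_on_mult[OF assms(1,2)]] by simp
next
  case Divide
  have nz: "r x \<noteq> 0" if "x \<in> U" for x
    using assms(3)[OF that] Divide by auto
  show ?thesis using that[OF rational_on_divide[OF assms(1,2) nz]] nz Divide by simp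
qed

text \<open>Induction over the tree, with one open region \<open>U k\<close> per index and the
  registers tracked as rational functions. A computation appends a register and a sign test shrinks
  the regions, so both vary in the induction. The separation hypothesis speaks of every open
  \<open>V\<close> in order to survive the shrinking. The base is 2, not 3: the zero branch is
  either taken at every point of the regions or avoided by shrinking.\<close>

lemma card_le_two_power_depth:
  fixes f :: "'k \<Rightarrow> ('i \<Rightarrow> real) \<Rightarrow> real"
  assumes "finite S"
    and "\<forall>r\<in>set rs. rational_on (\<Union>k\<in>S. U k) r"
    and "\<forall>k\<in>S. open (U k) \<and> U k \<noteq> {}"
    and "\<forall>k\<in>S. \<forall>x\<in>U k. run t (map (\<lambda>r. r x) rs) = Some (f k x)"
    and "\<forall>k\<in>S. rational_on (\<Union>k\<in>S. U k) (f k)"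
    and "\<forall>k\<in>S. \<forall>l\<in>S. \<forall>V. open V \<longrightarrow> V \<noteq> {} \<longrightarrow> V \<subseteq> U l \<longrightarrow> (\<forall>x\<in>V. f k x = f l x) \<longrightarrow> k = l"
  shows "card S \<le> 2 ^ depth t"
  using assms
proof (induction t arbitrary: S U rs)
  case (Output a)
  have "k = l" if kl: "k \<in> S" "l \<in> S" for k l
  proof -
    obtain z where "z \<in> U k"
      using Output.prems(3) kl by blast
    then obtain q where q: "rational_on (\<Union>k\<in>S. U k) q"
      "\<And>x. operand_val (map (\<lambda>r. r x) rs) a = Some (q x)"
      using Output.prems(2,4) kl by (elim operand_rational[where z = z and a = a]) auto
    have eq: "q x = f j x" if "j \<in> S" "x \<in> U j" for j x
      using Output.prems(4) q(2)[of x] that by simp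
    \<comment> \<open>The leaf outputs one function \<open>q\<close>. It equals \<open>f k\<close>
      on \<open>U k\<close>, hence on all regions by the identity principle, and in particular on
      \<open>U l\<close>, where it also equals \<open>f l\<close>.\<close>
    have "q x = f k x" if "x \<in> (\<Union>k\<in>S. U k)" for x
    proof (rule rational_on_identity[OF q(1) _ _ _ _ _ that])
      show "rational_on (\<Union>k\<in>S. U k) (f k)" "open (U k)" "U k \<noteq> {}" "U k \<subseteq> (\<Union>k\<in>S. U k)"
        using Output.prems(3,5) kl(1) by blast+
    qed (rule eq[OF kl(1)])
    hence "\<forall>x\<in>U l. f k x = f l x"
      using eq[OF kl(2)] kl(2) by (metis UN_I)
    thus "k = l"
      using Output.prems(3,6) kl by blast
  qed
  hence "card S \<le> 1"
    using Output.prems(1) by (auto simp: card_le_Suc0_iff_eq)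
  thus ?case by simp
next
  case (Compute op a b t)
  show ?case
  proof (cases "S = {}")
    case False
    then obtain z where z: "z \<in> (\<Union>k\<in>S. U k)"
      using Compute.prems(3) by blast
    have run: "run (Compute op a b t) (map (\<lambda>r. r x) rs) \<noteq> None" if "x \<in> (\<Union>k\<in>S. U k)" for x
      using Compute.prems(4) that by auto
    have "operand_val (map (\<lambda>r. r z) rs) a \<noteq> None"
      using run[OF z] by (auto simp: Option.bind_eq_Some_conv)
    then obtain q where q: "rational_on (\<Union>k\<in>S. U k) q"
      "\<And>x. operand_val (map (\<lambda>r. r x) rs) a = Some (q x)"
      using Compute.prems(2) z by (elim operand_rational[where z = z and a = a]) auto
    have "operand_val (map (\<lambda>r. r z) rs) b \<noteq> None"
      using run[OF z] q(2) by (auto simp: Option.bind_eq_Some_conv)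
    then obtain r where r: "rational_on (\<Union>k\<in>S. U k) r"
      "\<And>x. operand_val (map (\<lambda>r. r x) rs) b = Some (r x)"
      using Compute.prems(2) z by (elim operand_rational[where z = z]) auto
    have "arith_val op (q x) (r x) \<noteq> None" if "x \<in> (\<Union>k\<in>S. U k)" for x
      using run[OF that] q(2) r(2) by (auto simp: Option.bind_eq_Some_conv)
    then obtain s where s: "rational_on (\<Union>k\<in>S. U k) s"
      "\<And>x. x \<in> (\<Union>k\<in>S. U k) \<Longrightarrow> arith_val op (q x) (r x) = Some (s x)"
      using arith_rational[OF q(1) r(1)] by metis
    have "\<forall>k\<in>S. \<forall>x\<in>U k. run t (map (\<lambda>r. r x) (rs @ [s])) = Some (f k x)"
    proof (intro ballI)
      fix k x assume "k \<in> S" "x \<in> U k"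
      hence "run (Compute op a b t) (map (\<lambda>r. r x) rs) = Some (f k x)"
          "x \<in> (\<Union>k\<in>S. U k)"
        using Compute.prems(4) by blast+
      thus "run t (map (\<lambda>r. r x) (rs @ [s])) = Some (f k x)"
        using s(2)[of x] by (simp add: q(2) r(2) del: UN_iff)
    qed
    moreover have "\<forall>r\<in>set (rs @ [s]). rational_on (\<Union>k\<in>S. U k) r"
      using Compute.prems(2) s(1) by simp
    ultimately have "card S \<le> 2 ^ depth t"
      using Compute.IH[of S "rs @ [s]" U] Compute.prems by blast
    thus ?thesis by simp
  qed simp
next
  case (Sign_Test a t1 t2 t3)
  have d: "(2::nat) ^ depth t1 \<le> 2 ^ max (depth t1) (max (depth t2) (depth t3))"
    "(2::nat) ^ depth t2 \<le> 2 ^ max (depth t1) (max (depth t2) (depth t3))"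
    "(2::nat) ^ depth t3 \<le> 2 ^ max (depth t1) (max (depth t2) (depth t3))"
    by (intro power_increasing; simp)+
  show ?case
  proof (cases "S = {}")
    case False
    then obtain z where z: "z \<in> (\<Union>k\<in>S. U k)"
      using Sign_Test.prems(3) by blast
    hence "run (Sign_Test a t1 t2 t3) (map (\<lambda>r. r z) rs) \<noteq> None"
      using Sign_Test.prems(4) by auto
    hence "operand_val (map (\<lambda>r. r z) rs) a \<noteq> None"
      by (auto simp: Option.bind_eq_Some_conv)
    then obtain q where q: "rational_on (\<Union>k\<in>S. U k) q"
      "\<And>x. operand_val (map (\<lambda>r. r x) rs) a = Some (q x)"
      using Sign_Test.prems(2) z by (elim operand_rational[where z = z]) auto
    obtain N D where ND: "line_polynomial N" "line_polynomial D"
      "\<And>x. x \<in> (\<Union>k\<in>S. U k) \<Longrightarrow> D x \<noteq> 0" "\<And>x. x \<in> (\<Union>k\<in>S. U k) \<Longrightarrow> q x = N x / D x"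
      using q(1) by (rule rational_onE) blast
    show ?thesis
    proof (cases "\<forall>x. N x = 0")
      case True
      hence "\<forall>k\<in>S. \<forall>x\<in>U k. run t2 (map (\<lambda>r. r x) rs) = Some (f k x)"
        using Sign_Test.prems(4) q(2) ND(4) by fastforce
      hence "card S \<le> 2 ^ depth t2"
        using Sign_Test.IH(2)[of S rs U] Sign_Test.prems by blast
      thus ?thesis
        unfolding depth.simps power_Suc using d(2) by linarith
    next
      case False
      \<comment> \<open>On the regions the tested value \<open>N x / D x\<close> has the sign of
        \<open>N x * D x\<close>, which is continuous everywhere; so the two strict outcomes are cut
        out by open sets.\<close>
      define A where "A = {x. 0 < N x * D x}"
      define B where "B = {x. N x * D x < 0}"
      have cont: "continuous_on UNIV (\<lambda>x. N x * D x)"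
        using ND(1,2) by (auto simp: line_polynomial_def intro: continuous_on_mult)
      have AB: "open A" "open B"
        unfolding A_def B_def using cont by (auto intro!: open_Collect_less)
      \<comment> \<open>The induction hypothesis for a subfamily whose regions are cut down to an
        open set \<open>W\<close> on which one strict outcome prevails.\<close>
      have subset: "card T \<le> 2 ^ depth t'"
        if T: "T \<subseteq> S" "\<forall>k\<in>T. U k \<inter> W \<noteq> {}" and W: "open W"
          and run: "\<forall>k\<in>T. \<forall>x\<in>U k \<inter> W. run t' (map (\<lambda>r. r x) rs) = Some (f k x)"
          and t': "t' = t1 \<or> t' = t3" for T W t'
      proof -
        have sub: "(\<Union>k\<in>T. U k \<inter> W) \<subseteq> (\<Union>k\<in>S. U k)"
          using T(1) by blast
        have "finite T"
          using T(1) Sign_Test.prems(1) finite_subset by blast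
        moreover have "\<forall>r\<in>set rs. rational_on (\<Union>k\<in>T. U k \<inter> W) r"
          using Sign_Test.prems(2) rational_on_subset[OF _ sub] by blast
        moreover have "\<forall>k\<in>T. open (U k \<inter> W) \<and> U k \<inter> W \<noteq> {}"
          using T W Sign_Test.prems(3) by blast
        moreover have "\<forall>k\<in>T. rational_on (\<Union>k\<in>T. U k \<inter> W) (f k)"
          using Sign_Test.prems(5) rational_on_subset[OF _ sub] T(1) by blast
        moreover have "\<forall>k\<in>T. \<forall>l\<in>T. \<forall>V. open V \<longrightarrow> V \<noteq> {} \<longrightarrow> V \<subseteq> U l \<inter> W \<longrightarrow>
            (\<forall>x\<in>V. f k x = f l x) \<longrightarrow> k = l"
          using Sign_Test.prems(6) T(1) by (meson le_infE subsetD)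
        ultimately show ?thesis
          using t' run Sign_Test.IH(1)[of T rs "\<lambda>k. U k \<inter> W"]
            Sign_Test.IH(3)[of T rs "\<lambda>k. U k \<inter> W"] by blast
      qed
      have pos: "q x > 0" if "x \<in> U k \<inter> A" "k \<in> S" for k x
        using that ND(4)[of x] by (fastforce simp: A_def zero_less_divide_iff zero_less_mult_iff)
      have neg: "q x < 0" if "x \<in> U k \<inter> B" "k \<in> S" for k x
        using that ND(4)[of x] by (fastforce simp: B_def divide_less_0_iff mult_less_0_iff)
      \<comment> \<open>A region missing both \<open>A\<close> and \<open>B\<close> would lie in the
        zero set of \<open>N\<close>, and then \<open>N\<close> would vanish identically.\<close>
      have meets: "U k \<inter> B \<noteq> {}" if k: "k \<in> S" and "U k \<inter> A = {}" for k
      proof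
        assume "U k \<inter> B = {}"
        hence "N x = 0" if "x \<in> U k" for x
          using that \<open>U k \<inter> A = {}\<close> ND(3)[of x] k unfolding A_def B_def
          by (metis (mono_tags, lifting) UN_iff disjoint_iff linorder_neqE_linordered_idom
              mem_Collect_eq mult_eq_0_iff)
        thus False
          using line_polynomial_eq_0[OF ND(1), of "U k"] Sign_Test.prems(3) k False by blast
      qed
      \<comment> \<open>Each index is charged to one strict branch only: to the positive one if its
        region meets \<open>A\<close>, otherwise to the negative one.\<close>
      define S1 where "S1 = {k\<in>S. U k \<inter> A \<noteq> {}}"
      have "card S1 \<le> 2 ^ depth t3"
      proof (rule subset[of _ A])
        show "\<forall>k\<in>S1. \<forall>x\<in>U k \<inter> A. run t3 (map (\<lambda>r. r x) rs) = Some (f k x)"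
          using Sign_Test.prems(4) q(2) pos unfolding S1_def by fastforce
      qed (use AB in \<open>auto simp: S1_def\<close>)
      moreover have "card (S - S1) \<le> 2 ^ depth t1"
      proof (rule subset[of _ B])
        show "\<forall>k\<in>S - S1. \<forall>x\<in>U k \<inter> B. run t1 (map (\<lambda>r. r x) rs) = Some (f k x)"
          using Sign_Test.prems(4) q(2) neg by fastforce
      qed (use AB meets in \<open>auto simp: S1_def\<close>)
      moreover have "card S = card S1 + card (S - S1)"
        using Sign_Test.prems(1) by (metis (no_types, lifting) S1_def card_Diff_subset
            card_mono finite_subset le_add_diff_inverse mem_Collect_eq subsetI)
      ultimately show ?thesis
        unfolding depth.simps power_Suc using d by linarith
    qed
  qed simp
qed

section \<open>The indicator on the reciprocal diagonal\<close>

definition gap_cost :: "real \<Rightarrow> real" where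
  "gap_cost y = 1 / (2 * (1 - y)) - (1 - y) / 2"

text \<open>Between neighbours \<open>a\<close> and \<open>b\<close> the integrand follows the
  rising line \<open>l / a\<close> and then the falling line \<open>(1 - l) / (1 - b)\<close>;
  \<open>c\<close> is where they cross. For \<open>a = 0\<close> the crossing is at 0 and for
  \<open>b = 1\<close> it is at 1, so the piece with the undefined slope has length zero, and
  division by zero gives it the value 0.\<close>

lemma has_integral_gap_cost:
  assumes ab: "0 \<le> a" "a < b" "b \<le> 1" "b - a < 1" and c: "c = a / (1 - (b - a))"
    and left: "\<And>l. a < l \<Longrightarrow> l < c \<Longrightarrow> m l = l / a"
    and right: "\<And>l. c < l \<Longrightarrow> l < b \<Longrightarrow> m l = (1 - l) / (1 - b)"
  shows "(m has_integral gap_cost (b - a)) {a..b}"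
proof -
  define d where "d = 1 - (b - a)"
  have d: "0 < d" "d \<le> 1" "c = a / d" "1 - c = (1 - b) / d" "a + (1 - b) = d"
    using ab by (auto simp: d_def c field_simps)
  have "a * d \<le> a"
    using d ab(1) by (simp add: mult_left_le)
  hence ac: "a \<le> c"
    using d by (simp add: pos_le_divide_eq)
  have "a * (1 - b) \<le> b * (1 - b)"
    using ab by (intro mult_right_mono) auto
  hence "a \<le> b * d"
    by (simp add: d_def algebra_simps)
  hence cb: "c \<le> b"
    using d by (simp add: pos_divide_le_eq)
  have "((\<lambda>l. l / a) has_integral (c\<^sup>2 / (2 * a) - a\<^sup>2 / (2 * a))) {a..c}"
    by (cases "a = 0"; rule fundamental_theorem_of_calculus[OF ac])
      (auto intro!: derivative_eq_intros simp flip: has_real_derivative_iff_has_vector_derivative)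
  \<comment> \<open>The formula for \<open>m\<close> is known only strictly inside the interval; the
    two end points do not affect the integral.\<close>
  hence L: "(m has_integral (c\<^sup>2 / (2 * a) - a\<^sup>2 / (2 * a))) {a..c}"
    by (rule has_integral_spike_finite[of "{a, c}", rotated 2]) (auto intro!: left)
  have "((\<lambda>l. (1 - l) / k) has_integral (- (1 - b)\<^sup>2 / (2 * k) - - (1 - c)\<^sup>2 / (2 * k))) {c..b}" for k
    by (cases "k = 0"; rule fundamental_theorem_of_calculus[OF cb])
      (auto intro!: derivative_eq_intros simp: diff_divide_distrib
        simp flip: has_real_derivative_iff_has_vector_derivative)
  hence R: "(m has_integral
      (- (1 - b)\<^sup>2 / (2 * (1 - b)) - - (1 - c)\<^sup>2 / (2 * (1 - b)))) {c..b}"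
    by (rule has_integral_spike_finite[of "{c, b}", rotated 2]) (auto intro!: right)
  have "c\<^sup>2 / (2 * a) - a\<^sup>2 / (2 * a) = a / (2 * d\<^sup>2) - a / 2"
    using d by (cases "a = 0") (auto simp: power2_eq_square field_simps)
  moreover have "- k\<^sup>2 / (2 * k) - - (k / d)\<^sup>2 / (2 * k) = k / (2 * d\<^sup>2) - k / 2" for k
    using d(1) by (cases "k = 0") (auto simp: power2_eq_square field_simps)
  \<comment> \<open>The numerators of the two pieces add up to \<open>d\<close>, which leaves
    \<open>1 / (2 * d) - d / 2\<close>.\<close>
  moreover have "a / (2 * d\<^sup>2) - a / 2 + ((1 - b) / (2 * d\<^sup>2) - (1 - b) / 2) =
      (a + (1 - b)) / (2 * d\<^sup>2) - (a + (1 - b)) / 2"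
    by (simp add: add_divide_distrib diff_divide_distrib)
  moreover have "\<dots> = gap_cost (b - a)"
    using d(1) unfolding d(5) gap_cost_def d_def[symmetric] by (simp add: power2_eq_square)
  ultimately show ?thesis
    using has_integral_combine[OF ac cb L R] unfolding d(4) by metis
qed

lemma has_integral_adjacent:
  fixes f :: "real \<Rightarrow> real"
  assumes "sorted_wrt (<) xs" "xs \<noteq> []"
    and "\<forall>(a, b)\<in>set (zip xs (tl xs)). (f has_integral w a b) {a..b}"
  shows "(f has_integral (\<Sum>(a, b)\<leftarrow>zip xs (tl xs). w a b)) {hd xs..last xs}"
  using assms
proof (induction xs rule: induct_list012)
  case (3 a b xs)
  hence "(f has_integral (\<Sum>(a, b)\<leftarrow>zip (b # xs) xs. w a b)) {b..last (b # xs)}"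
    by simp
  moreover have "(f has_integral w a b) {a..b}"
    using 3 by simp
  moreover have "a \<le> b" "b \<le> last (b # xs)"
    using 3(3) by (auto intro: less_imp_le)
  ultimately show ?case
    using has_integral_combine[of a b "last (b # xs)" f "w a b"] by simp
qed (auto intro!: has_integral_null simp: content_real_eq_0)

lemma adjacent_cases:
  fixes s :: "'a :: linorder"
  assumes "sorted_wrt (<) xs" "(a, b) \<in> set (zip xs (tl xs))" "s \<in> set xs"
  shows "s \<le> a \<or> b \<le> s"
  using assms
proof (induction xs rule: induct_list012)
  case (3 x y xs)
  have "a = x \<and> b = y \<or> (a, b) \<in> set (zip (y # xs) (tl (y # xs)))"
    using 3(4) by auto
  thus ?case
  proof
    assume "a = x \<and> b = y"
    thus ?case
      using 3(3,5) by (auto intro: less_imp_le)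
  next
    assume ab: "(a, b) \<in> set (zip (y # xs) (tl (y # xs)))"
    hence "x < a"
      using 3(3) set_zip_leftD[OF ab] by auto
    thus ?case
      using 3(2)[OF _ ab] 3(3,5) by auto
  qed
qed auto

lemma adjacent_less:
  assumes "sorted_wrt (<) xs" "(a, b) \<in> set (zip xs (tl xs))"
  shows "a < b"
  using assms by (induction xs rule: induct_list012) auto

text \<open>Both arguments of the maximum are 1 at \<open>l = s\<close>; the first increases with
  \<open>l\<close>, the second decreases.\<close>

lemma max_ray_left:
  fixes s :: real
  assumes "0 < s" "s < 1" "s \<le> l"
  shows "max (l / s) ((1 - l) / (1 - s)) = l / s"
proof -
  have "(1 - l) / (1 - s) \<le> 1" "1 \<le> l / s"
    using assms by (auto simp: field_simps)
  thus ?thesis by simp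
qed

lemma max_ray_right:
  fixes s :: real
  assumes "0 < s" "s < 1" "l \<le> s"
  shows "max (l / s) ((1 - l) / (1 - s)) = (1 - l) / (1 - s)"
proof -
  have "1 \<le> (1 - l) / (1 - s)" "l / s \<le> 1"
    using assms by (auto simp: field_simps)
  thus ?thesis by simp
qed

text \<open>For \<open>l\<close> between neighbours \<open>a\<close> and \<open>b\<close>, a
  parameter \<open>s\<close> below contributes \<open>l / s\<close>, least at \<open>s = a\<close>,
  and one above contributes \<open>(1 - l) / (1 - s)\<close>, least at \<open>s = b\<close>. So only
  the two neighbours determine the minimum, and the integral splits into one term per gap.\<close>

lemma R2_reciprocal_diagonal:
  assumes sorted: "sorted_wrt (<) (0 # ss @ [1])" and ne: "ss \<noteq> []"
  shows "R2 ((\<lambda>s. (1 / s, 1 / (1 - s))) ` set ss) =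
    (\<Sum>(a, b)\<leftarrow>zip (0 # ss @ [1]) (ss @ [1]). gap_cost (b - a))"
proof -
  define m where "m l = (MIN s\<in>set ss. max (l / s) ((1 - l) / (1 - s)))" for l :: real
  have ss: "0 < s" "s < 1" if "s \<in> set ss" for s
    using sorted that by (auto simp: sorted_wrt_append)
  have m_le: "m l \<le> max (l / s) ((1 - l) / (1 - s))" if "s \<in> set ss" for l s
    unfolding m_def using that by (intro Min_le) auto
  have m_ge: "x \<le> m l" if "\<And>s. s \<in> set ss \<Longrightarrow> x \<le> l / s \<or> x \<le> (1 - l) / (1 - s)" for x l
    unfolding m_def using that ne by (subst Min_ge_iff) (auto simp: le_max_iff_disj)
  have "(m has_integral gap_cost (b - a)) {a..b}"
    if ab: "(a, b) \<in> set (zip (0 # ss @ [1]) (tl (0 # ss @ [1])))" for a b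
  proof -
    have less: "a < b"
      using adjacent_less[OF sorted ab] .
    have cases: "s \<le> a \<or> b \<le> s" if "s \<in> set ss" for s
      using adjacent_cases[OF sorted ab] that by simp
    have "a \<in> set (0 # ss @ [1])" "b \<in> set (0 # ss @ [1])"
      using ab by (auto dest: set_zip_leftD set_zip_rightD)
    hence a: "a = 0 \<or> a \<in> set ss" and b: "b = 1 \<or> b \<in> set ss"
      using less ss by fastforce+
    hence a01: "0 \<le> a" and b01: "b \<le> 1"
      using ss by fastforce+
    \<comment> \<open>The head of \<open>ss\<close> lies strictly between 0 and 1, so no gap has
      length 1, where \<open>gap_cost\<close> has its pole.\<close>
    have "\<not> (a = 0 \<and> b = 1)"
      using cases ss ne by (metis hd_in_set leD)
    hence gap: "b - a < 1"
      using a01 b01 by linarith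
    define c where "c = a / (1 - (b - a))"
    show ?thesis
    proof (rule has_integral_gap_cost[OF a01 less b01 gap c_def])
      fix l assume l: "a < l" "l < c"
      \<comment> \<open>With \<open>a = 0\<close> also \<open>c = 0\<close>, and no \<open>l\<close>
        would be left.\<close>
      hence "a \<noteq> 0"
        by (auto simp: c_def)
      hence aS: "a \<in> set ss" and a0: "0 < a"
        using a a01 by auto
      \<comment> \<open>Left of the crossing point the rising line is the lower one. If
        \<open>b = 1\<close>, no parameter lies to the right of the gap.\<close>
      have key: "l / a \<le> (1 - l) / (1 - b)" if "b < 1"
        using l(2) a0 that gap by (simp add: c_def field_simps)
      have "c \<le> 1"
        using gap b01 by (simp add: c_def field_simps)
      show "m l = l / a"
      proof (rule antisym)
        show "m l \<le> l / a"
          using m_le[OF aS, of l] max_ray_left[of a l] ss aS l by simp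
        show "l / a \<le> m l"
        proof (rule m_ge)
          fix s assume s: "s \<in> set ss"
          show "l / a \<le> l / s \<or> l / a \<le> (1 - l) / (1 - s)"
          proof (cases "s \<le> a")
            case True
            thus ?thesis
              using ss[OF s] l a0 by (auto intro!: divide_left_mono)
          next
            case False
            hence "b \<le> s"
              using cases[OF s] by simp
            hence "(1 - l) / (1 - b) \<le> (1 - l) / (1 - s)"
              using ss[OF s] l \<open>c \<le> 1\<close> by (intro divide_left_mono) auto
            thus ?thesis
              using key \<open>b \<le> s\<close> ss[OF s] by simp
          qed
        qed
      qed
    next
      fix l assume l: "c < l" "l < b"
      \<comment> \<open>With \<open>b = 1\<close> the crossing point is \<open>a / a = 1\<close>,
        since the gap is shorter than 1 and hence \<open>0 < a\<close>.\<close>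
      have "b \<noteq> 1"
        using l a01 gap by (auto simp: c_def)
      hence bS: "b \<in> set ss" and b1: "b < 1"
        using b b01 by auto
      have "0 \<le> c"
        using gap a01 by (simp add: c_def)
      have key: "(1 - l) / (1 - b) \<le> l / a" if "0 < a"
        using l(1) b1 that gap by (simp add: c_def field_simps)
      show "m l = (1 - l) / (1 - b)"
      proof (rule antisym)
        show "m l \<le> (1 - l) / (1 - b)"
          using m_le[OF bS, of l] max_ray_right[of b l] ss bS l by simp
        show "(1 - l) / (1 - b) \<le> m l"
        proof (rule m_ge)
          fix s assume s: "s \<in> set ss"
          show "(1 - l) / (1 - b) \<le> l / s \<or> (1 - l) / (1 - b) \<le> (1 - l) / (1 - s)"
          proof (cases "s \<le> a")
            case True
            hence "l / a \<le> l / s"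
              using ss[OF s] l \<open>0 \<le> c\<close> by (intro divide_left_mono) auto
            thus ?thesis
              using key True ss[OF s] by simp
          next
            case False
            hence "b \<le> s"
              using cases[OF s] by simp
            thus ?thesis
              using ss[OF s] l b1 by (auto intro!: divide_left_mono)
          qed
        qed
      qed
    qed
  qed
  hence "(m has_integral (\<Sum>(a, b)\<leftarrow>zip (0 # ss @ [1]) (ss @ [1]). gap_cost (b - a))) {0..1}"
    using has_integral_adjacent[OF sorted, of m "\<lambda>a b. gap_cost (b - a)"] by auto
  moreover have "R2 ((\<lambda>s. (1 / s, 1 / (1 - s))) ` set ss) = integral {0..1} m"
    unfolding R2_def m_def by (simp add: image_image)
  ultimately show ?thesis
    by (simp add: integral_unique)
qed

section \<open>Distinct orderings give distinct rational functions\<close>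

text \<open>Vertices \<open>n\<close> and \<open>Suc n\<close> stand for the end points 0 and 1 of the parameter interval.\<close>

definition vertex :: "nat \<Rightarrow> (nat \<Rightarrow> real) \<Rightarrow> nat \<Rightarrow> real" where
  "vertex n x i = (if i < n then x i else if i = n then 0 else 1)"

definition path_edges :: "nat \<Rightarrow> nat list \<Rightarrow> (nat \<times> nat) set" where
  "path_edges n p = set (zip (n # p) (p @ [Suc n]))"

definition path_cost :: "nat \<Rightarrow> nat list \<Rightarrow> (nat \<Rightarrow> real) \<Rightarrow> real" where
  "path_cost n p x = (\<Sum>(u, v)\<in>path_edges n p. gap_cost (vertex n x v - vertex n x u))"

text \<open>Including the two end vertices confines the coordinates listed in a permutation
  \<open>p\<close> to the open unit interval.\<close>

definition cell :: "nat \<Rightarrow> nat list \<Rightarrow> (nat \<Rightarrow> real) set" where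
  "cell n p = {x. sorted_wrt (<) (map (vertex n x) (n # p @ [Suc n]))}"

text \<open>The pair \<open>(n, Suc n)\<close> is left out because its difference is constantly 1:
  its cost would be singular everywhere.\<close>

definition edges :: "nat \<Rightarrow> (nat \<times> nat) set" where
  "edges n = {(u, v). u \<le> n \<and> v \<le> Suc n \<and> v \<noteq> n \<and> u \<noteq> v \<and> (u, v) \<noteq> (n, Suc n)}"

definition regular_points :: "nat \<Rightarrow> (nat \<times> nat) set \<Rightarrow> (nat \<Rightarrow> real) set" where
  "regular_points n E = {x. \<forall>(u, v)\<in>E. vertex n x v - vertex n x u \<noteq> 1}"

lemma line_polynomial_vertex: "line_polynomial (\<lambda>x. vertex n x i)"
  by (cases "i < n"; cases "i = n") (simp_all add: vertex_def)

lemma zip_path_distinct: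
  assumes "distinct (a # xs @ [z])" "(u, v) \<in> set (zip (a # xs) (xs @ [z]))"
  shows "u \<noteq> v"
  using assms by (induction xs arbitrary: a) auto

text \<open>Positivity of \<open>n\<close> rules out the empty path, which joins the end vertices 0
  and 1 directly.\<close>

lemma path_edges_subset:
  assumes "p \<in> permutations_of_set {..<n}" "0 < n"
  shows "path_edges n p \<subseteq> edges n"
proof safe
  fix u v assume uv: "(u, v) \<in> path_edges n p"
  have p: "set p = {..<n}" "distinct p"
    using assms(1) by (auto simp: permutations_of_set_def)
  have uv': "(u, v) \<in> set (zip (n # p) (p @ [Suc n]))"
    using uv by (simp add: path_edges_def)
  have "u \<in> set (n # p)" "v \<in> set (p @ [Suc n])"
    using set_zip_leftD[OF uv'] set_zip_rightD[OF uv'] by auto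
  moreover have "u \<noteq> v"
    by (rule zip_path_distinct[OF _ uv']) (use p in auto)
  moreover have "(u, v) \<noteq> (n, Suc n)"
  proof (cases p)
    case (Cons a q)
    have "n \<notin> set p" "Suc n \<notin> set p"
      using p by auto
    hence "(n, Suc n) \<notin> set (zip p (q @ [Suc n]))" "a \<noteq> Suc n"
      using set_zip_leftD[of n "Suc n" p] Cons by auto
    thus ?thesis
      using uv' Cons by auto
  qed (use p assms(2) in auto)
  ultimately show "(u, v) \<in> edges n"
    unfolding edges_def by (simp add: p(1)) linarith
qed

text \<open>A path is recovered from its start by following successors: among the edges of the
  second path \<open>a\<close> is a source only once, so the next vertices coincide.\<close>

lemma zip_path_subset_imp_eq:
  assumes "distinct (a # xs)" "distinct (a # ys)" "length xs = length ys"
    and "set (zip (a # xs) (xs @ [z])) \<subseteq> set (zip (a # ys) (ys @ [z]))"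
  shows "xs = ys"
  using assms
proof (induction xs arbitrary: a ys)
  case (Cons b xs)
  then obtain c ys' where ys: "ys = c # ys'"
    by (cases ys) auto
  have "(a, b) \<notin> set (zip ys (ys' @ [z]))"
    using Cons.prems(2) by (auto dest: set_zip_leftD)
  hence [simp]: "c = b"
    using Cons.prems(4) ys by auto
  have "set (zip (b # xs) (xs @ [z])) \<subseteq> set (zip (b # ys') (ys' @ [z]))"
  proof
    fix e assume e: "e \<in> set (zip (b # xs) (xs @ [z]))"
    hence "fst e \<noteq> a"
      using Cons.prems(1) by (metis distinct.simps(2) prod.collapse set_zip_leftD)
    thus "e \<in> set (zip (b # ys') (ys' @ [z]))"
      using Cons.prems(4) e ys by auto
  qed
  hence "xs = ys'"
    using Cons.IH[of b ys'] Cons.prems ys by simp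
  thus ?case
    using ys by simp
qed simp

text \<open>A point at the pole of one prescribed edge and of no other candidate edge. In each case
  the values are chosen so that the only ordered pairs with difference 1 are \<open>(u, v)\<close>
  and the excluded \<open>(n, Suc n)\<close>. The point may lie outside all cells, since rational
  identities extend to it.\<close>

lemma ex_singular_point:
  assumes uv: "(u, v) \<in> edges n"
  obtains x where "vertex n x v - vertex n x u = 1" "x \<in> regular_points n (edges n - {(u, v)})"
proof -
  have "\<exists>x. \<forall>(i, j)\<in>edges n. vertex n x j - vertex n x i = 1 \<longleftrightarrow> (i, j) = (u, v)"
  proof -
    consider "u = n" "v < n" | "u < n" "v = Suc n" | "u < n" "v < n" "u \<noteq> v"
      using uv by (auto simp: edges_def) linarith+
    thus ?thesis
    proof cases
      case 1
      have val: "vertex n (\<lambda>i. if i = v then 1 else 3) k =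
          (if k = n then 0 else if k < n \<and> k \<noteq> v then 3 else 1)" for k
        by (simp add: vertex_def)
      show ?thesis
        by (rule exI[of _ "\<lambda>i. if i = v then 1 else 3"], simp only: val)
          (use 1 in \<open>auto simp: edges_def\<close>)
    next
      case 2
      have val: "vertex n (\<lambda>i. if i = u then 0 else 3) k =
          (if k = n \<or> k = u then 0 else if k < n then 3 else 1)" for k
        using 2 by (simp add: vertex_def)
      show ?thesis
        by (rule exI[of _ "\<lambda>i. if i = u then 0 else 3"], simp only: val)
          (use 2 in \<open>auto simp: edges_def\<close>)
    next
      case 3
      have val: "vertex n (\<lambda>i. if i = u then 5 else if i = v then 6 else 3) k =
          (if k = u then 5 else if k = v then 6 else if k < n then 3 else if k = n then 0 else 1)" for k
        using 3 by (simp add: vertex_def)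
      show ?thesis
        by (rule exI[of _ "\<lambda>i. if i = u then 5 else if i = v then 6 else 3"], simp only: val)
          (use 3 in \<open>auto simp: edges_def\<close>)
    qed
  qed
  then obtain x where x:
    "\<forall>(i, j)\<in>edges n. vertex n x j - vertex n x i = 1 \<longleftrightarrow> (i, j) = (u, v)" ..
  show ?thesis
  proof (rule that)
    show "vertex n x v - vertex n x u = 1"
      using bspec[OF x uv] by simp
    show "x \<in> regular_points n (edges n - {(u, v)})"
      using x by (auto simp: regular_points_def)
  qed
qed

lemma rational_on_gap_cost:
  assumes "rational_on U r" "\<And>x. x \<in> U \<Longrightarrow> r x \<noteq> 1"
  shows "rational_on U (\<lambda>x. gap_cost (r x))"
proof -
  have const: "rational_on U (\<lambda>_. c)" for c
    by (simp add: rational_on_polynomial)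
  have "rational_on U (\<lambda>x. 1 - r x)"
    using const assms(1) by (rule rational_on_diff)
  moreover have "2 * (1 - r x) \<noteq> 0" if "x \<in> U" for x
    using assms(2)[OF that] by simp
  ultimately show ?thesis
    unfolding gap_cost_def
    by (intro rational_on_diff[OF rational_on_divide rational_on_divide] rational_on_mult const)
      auto
qed

lemma rational_on_gap_costs:
  assumes "T \<subseteq> E"
  shows "rational_on (regular_points n E)
    (\<lambda>x. \<Sum>(u, v)\<in>T. gap_cost (vertex n x v - vertex n x u))"
  unfolding case_prod_unfold
proof (rule rational_on_sum)
  fix e assume "e \<in> T"
  thus "rational_on (regular_points n E)
      (\<lambda>x. gap_cost (vertex n x (snd e) - vertex n x (fst e)))"
    using assms
    by (intro rational_on_gap_cost rational_on_polynomial line_polynomial_diff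
        line_polynomial_vertex) (auto simp: regular_points_def case_prod_unfold)
qed

text \<open>An edge of one path that is missing in the other one yields a pole of exactly one of the two
  cost functions.\<close>

lemma path_cost_eq_imp_eq:
  assumes p: "p \<in> permutations_of_set {..<n}" and q: "q \<in> permutations_of_set {..<n}"
    and n: "0 < n" and W: "open W" "W \<noteq> {}" "W \<subseteq> regular_points n (edges n)"
    and eq: "\<And>x. x \<in> W \<Longrightarrow> path_cost n p x = path_cost n q x"
  shows "p = q"
proof (rule ccontr)
  assume "p \<noteq> q"
  have pq: "distinct (n # p)" "distinct (n # q)" "length p = length q"
    using p q by (auto simp: permutations_of_set_def simp flip: distinct_card)
  hence "\<not> path_edges n p \<subseteq> path_edges n q"
    using zip_path_subset_imp_eq[OF pq] \<open>p \<noteq> q\<close> by (auto simp: path_edges_def)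
  then obtain u v where uv: "(u, v) \<in> path_edges n p" "(u, v) \<notin> path_edges n q"
    by auto
  define E where "E = edges n - {(u, v)}"
  define y where "y x = vertex n x v - vertex n x u" for x
  define R where "R x = (\<Sum>(i, j)\<in>path_edges n p - {(u, v)}.
    gap_cost (vertex n x j - vertex n x i)) - path_cost n q x" for x
  \<comment> \<open>Where \<open>y x\<close> is not 1, this is \<open>2 * (1 - y x)\<close> times
    the difference of the two path costs. With the pole cleared it is also rational at
    \<open>z\<close>, where it takes the value 1.\<close>
  define F where "F x = (2 * (1 - y x)) * R x + (1 - (1 - y x) * (1 - y x))" for x
  have uvE: "(u, v) \<in> edges n"
    using path_edges_subset[OF p n] uv by auto
  obtain z where z: "y z = 1" "z \<in> regular_points n E"
    using ex_singular_point[OF uvE] unfolding y_def E_def by blast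
  have "rational_on (regular_points n E) (\<lambda>x. \<Sum>(i, j)\<in>path_edges n p - {(u, v)}.
      gap_cost (vertex n x j - vertex n x i))"
    using path_edges_subset[OF p n] by (intro rational_on_gap_costs) (auto simp: E_def)
  moreover have "rational_on (regular_points n E) (path_cost n q)"
    using path_edges_subset[OF q n] uv unfolding path_cost_def
    by (intro rational_on_gap_costs) (auto simp: E_def)
  ultimately have R: "rational_on (regular_points n E) R"
    unfolding R_def by (rule rational_on_diff)
  have "rational_on (regular_points n E) y"
    unfolding y_def
    by (intro rational_on_polynomial line_polynomial_diff line_polynomial_vertex)
  hence F: "rational_on (regular_points n E) F"
    unfolding F_def using R
    by (intro rational_on_add rational_on_diff rational_on_mult
        rational_on_polynomial[OF line_polynomial_const])
  have WE: "W \<subseteq> regular_points n E"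
    using W(3) by (auto simp: regular_points_def E_def)
  have F0: "F x = 0" if x: "x \<in> W" for x
  proof -
    have "1 - y x \<noteq> 0"
      using x W(3) uvE by (force simp: regular_points_def y_def)
    moreover have "path_cost n p x = gap_cost (y x) + (\<Sum>(i, j)\<in>path_edges n p - {(u, v)}.
        gap_cost (vertex n x j - vertex n x i))"
      unfolding path_cost_def y_def using uv(1)
      by (subst sum.remove[of _ "(u, v)"]) (auto simp: path_edges_def)
    hence "gap_cost (y x) + R x = 0"
      using eq[OF x] by (simp add: R_def)
    hence "R x = (1 - y x) / 2 - 1 / (2 * (1 - y x))"
      unfolding gap_cost_def by linarith
    ultimately show ?thesis
      unfolding F_def by (simp add: field_simps)
  qed
  have "F z = 0"
    using rational_on_identity[OF F rational_on_polynomial[OF line_polynomial_const] W(1,2) WE F0 z(2)] .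
  thus False
    by (simp add: F_def z(1))
qed

section \<open>Cells of orderings\<close>

lemma open_sorted_wrt_less:
  fixes g :: "'b \<Rightarrow> 'a :: topological_space \<Rightarrow> real"
  assumes "\<And>i. continuous_on UNIV (g i)"
  shows "open {x. sorted_wrt (<) (map (\<lambda>i. g i x) is)}"
proof (induction "is")
  case (Cons i "is")
  have "{x. sorted_wrt (<) (map (\<lambda>i. g i x) (i # is))} =
      (\<Inter>j\<in>set is. {x. g i x < g j x}) \<inter> {x. sorted_wrt (<) (map (\<lambda>i. g i x) is)}"
    by auto
  thus ?case
    using Cons assms by (auto intro!: open_Int open_INT open_Collect_less)
qed simp

lemma open_cell: "open (cell n p)"
  unfolding cell_def
  using line_polynomial_vertex by (intro open_sorted_wrt_less) (auto simp: line_polynomial_def)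

lemma map_vertex_path:
  assumes "set p = {..<n}"
  shows "map (vertex n x) (n # p @ [Suc n]) = 0 # map x p @ [1]"
  using assms by (auto simp: vertex_def)

lemma cell_nonempty:
  assumes "p \<in> permutations_of_set {..<n}"
  shows "cell n p \<noteq> {}"
proof -
  have p: "set p = {..<n}" "distinct p" "length p = n"
    using assms by (auto simp: permutations_of_set_def simp flip: distinct_card)
  \<comment> \<open>Equally spaced interior points of the unit interval, assigned to the indices in
    the order \<open>p\<close>; adding 1 to \<open>k\<close> and to \<open>n\<close> keeps them away
    from 0 and 1.\<close>
  define ys where "ys = map (\<lambda>k. (real k + 1) / (real n + 1)) [0..<n]"
  define x where "x i = the (map_of (zip p ys) i)" for i
  have "map x p = ys"
    by (rule nth_equalityI) (auto simp: x_def ys_def p map_of_zip_nth)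
  moreover have "sorted_wrt (<) (0 # ys @ [1])"
    by (auto simp: ys_def sorted_wrt_append sorted_wrt_iff_nth_less[of _ "map _ _"]
        divide_strict_right_mono)
  ultimately have "x \<in> cell n p"
    unfolding cell_def mem_Collect_eq map_vertex_path[OF p(1)] by simp
  thus ?thesis by blast
qed

lemma cell_bounds:
  assumes "x \<in> cell n p" "set p = {..<n}" "i < n"
  shows "0 < x i" "x i < 1"
  using assms unfolding cell_def mem_Collect_eq map_vertex_path[OF assms(2)]
  by (auto simp: sorted_wrt_append)

text \<open>With all coordinates strictly between 0 and 1, a difference of 1 occurs only between the
  two end vertices, and that pair is not in \<open>edges n\<close>.\<close>

lemma cell_subset_regular_points:
  assumes "set p = {..<n}"
  shows "cell n p \<subseteq> regular_points n (edges n)"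
proof -
  have "vertex n x v - vertex n x u \<noteq> 1" if "x \<in> cell n p" "(u, v) \<in> edges n" for x u v
    using that(2) cell_bounds[OF that(1) assms, of u] cell_bounds[OF that(1) assms, of v]
    by (auto simp: edges_def vertex_def)
  thus ?thesis
    by (auto simp: regular_points_def)
qed

lemma R2_cell:
  assumes "p \<in> permutations_of_set {..<n}" "0 < n" "x \<in> cell n p"
  shows "R2 ((\<lambda>i. (1 / x i, 1 / (1 - x i))) ` {..<n}) = path_cost n p x"
proof -
  have p: "set p = {..<n}" "distinct p"
    using assms(1) by (auto simp: permutations_of_set_def)
  have zip: "zip (0 # map x p @ [1]) (map x p @ [1]) =
      map (map_prod (vertex n x) (vertex n x)) (zip (n # p) (p @ [Suc n]))"
  proof -
    \<comment> \<open>The left list is longer by one entry, which \<open>zip\<close> drops.\<close>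
    have "zip (0 # map x p @ [1]) (map x p @ [1]) = zip (0 # map x p) (map x p @ [1])"
      using zip_append1[of "0 # map x p" "[1]" "map x p @ [1]"] by simp
    also have "\<dots> = zip (map (vertex n x) (n # p)) (map (vertex n x) (p @ [Suc n]))"
      using p by (intro arg_cong2[of _ _ _ _ zip]) (auto simp: vertex_def)
    finally show ?thesis
      by (simp only: zip_map_map map_prod_def)
  qed
  have "sorted_wrt (<) (0 # map x p @ [1])"
    using assms(3) unfolding cell_def mem_Collect_eq map_vertex_path[OF p(1)] .
  moreover have "map x p \<noteq> []"
    using p(1) assms(2) by (metis Nil_is_map_conv empty_iff empty_set lessThan_iff)
  ultimately have "R2 ((\<lambda>s. (1 / s, 1 / (1 - s))) ` set (map x p)) =
      (\<Sum>(a, b)\<leftarrow>zip (0 # map x p @ [1]) (map x p @ [1]). gap_cost (b - a))"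
    by (rule R2_reciprocal_diagonal)
  also have "\<dots> = (\<Sum>(u, v)\<leftarrow>zip (n # p) (p @ [Suc n]). gap_cost (vertex n x v - vertex n x u))"
    unfolding zip by (simp only: map_map comp_def case_prod_unfold fst_map_prod snd_map_prod)
  also have "\<dots> = path_cost n p x"
    unfolding path_cost_def path_edges_def
    by (intro sum_list_distinct_conv_sum_set distinct_zipI1) (use p in auto)
  finally show ?thesis
    using p by (simp add: image_image)
qed

section \<open>The lower bound\<close>

lemma fact_le_two_power_depth:
  assumes t: "computes_R2 reciprocal_diagonal n t" and n: "0 < n"
  shows "fact n \<le> (2 :: nat) ^ depth t"
proof -
  define S where "S = permutations_of_set {..<n}"
  \<comment> \<open>The points are listed by index, whatever their order on the curve. All
    \<open>n!\<close> cells thus start the tree with the same register functions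
    \<open>rs\<close>.\<close>
  define pts where "pts x = map (\<lambda>i. (1 / x i, 1 / (1 - x i))) [0..<n]" for x :: "nat \<Rightarrow> real"
  define rs :: "((nat \<Rightarrow> real) \<Rightarrow> real) list" where
    "rs = concat (map (\<lambda>i. [\<lambda>x. 1 / x i, \<lambda>x. 1 / (1 - x i)]) [0..<n])"
  have S: "set p = {..<n}" "distinct p" if "p \<in> S" for p
    using that by (auto simp: S_def permutations_of_set_def)
  have regular: "(\<Union>p\<in>S. cell n p) \<subseteq> regular_points n (edges n)"
    using cell_subset_regular_points S by blast
  have "card S \<le> 2 ^ depth t"
  proof (rule card_le_two_power_depth[of S rs "cell n" t "path_cost n"])
    show "finite S"
      by (simp add: S_def)
    have "rational_on (\<Union>p\<in>S. cell n p) (\<lambda>x. 1 / x i)"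
      "rational_on (\<Union>p\<in>S. cell n p) (\<lambda>x. 1 / (1 - x i))" if "i < n" for i
      using cell_bounds[OF _ S(1) that]
      by (intro rational_on_inverse rational_on_polynomial line_polynomial_diff; force)+
    thus "\<forall>r\<in>set rs. rational_on (\<Union>p\<in>S. cell n p) r"
      by (auto simp: rs_def)
    show "\<forall>p\<in>S. open (cell n p) \<and> cell n p \<noteq> {}"
      using open_cell cell_nonempty by (auto simp: S_def)
    show "\<forall>p\<in>S. \<forall>x\<in>cell n p. run t (map (\<lambda>r. r x) rs) = Some (path_cost n p x)"
    proof (intro ballI)
      fix p x assume p: "p \<in> S" and x: "x \<in> cell n p"
      have "sorted_wrt (<) (map x p)"
        using x unfolding cell_def mem_Collect_eq map_vertex_path[OF S(1)[OF p]]
        by (simp add: sorted_wrt_append)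
      hence "inj_on x {..<n}"
        using S[OF p] by (metis distinct_map strict_sorted_iff)
      hence "distinct (pts x)"
        using cell_bounds[OF x S(1)[OF p]]
        by (auto simp: pts_def distinct_map inj_on_def)
      moreover have "set (pts x) \<subseteq> reciprocal_diagonal"
        using cell_bounds[OF x S(1)[OF p]] by (auto simp: pts_def reciprocal_diagonal_def)
      moreover have "length (pts x) = n"
        by (simp add: pts_def)
      ultimately have "run t (coordinates (pts x)) = Some (R2 (set (pts x)))"
        using t by (auto simp: computes_R2_def)
      moreover have "coordinates (pts x) = map (\<lambda>r. r x) rs"
        by (simp add: coordinates_def pts_def rs_def map_concat comp_def)
      moreover have "R2 (set (pts x)) = path_cost n p x"
        using R2_cell[OF _ n x] p by (simp add: S_def pts_def atLeast0LessThan)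
      ultimately show "run t (map (\<lambda>r. r x) rs) = Some (path_cost n p x)"
        by simp
    qed
    show "\<forall>p\<in>S. rational_on (\<Union>p\<in>S. cell n p) (path_cost n p)"
      using path_edges_subset n rational_on_subset[OF rational_on_gap_costs regular]
      by (simp add: S_def path_cost_def[abs_def])
    show "\<forall>p\<in>S. \<forall>q\<in>S. \<forall>V. open V \<longrightarrow> V \<noteq> {} \<longrightarrow> V \<subseteq> cell n q \<longrightarrow>
        (\<forall>x\<in>V. path_cost n p x = path_cost n q x) \<longrightarrow> p = q"
    proof (intro ballI allI impI)
      fix p q V
      assume "p \<in> S" "q \<in> S" "open V" "V \<noteq> {}" "V \<subseteq> cell n q"
        "\<forall>x\<in>V. path_cost n p x = path_cost n q x"
      thus "p = q"
        using path_cost_eq_imp_eq[of p n q V] n cell_subset_regular_points[OF S(1), of q]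
        by (auto simp: S_def)
    qed
  qed
  thus ?thesis
    by (simp add: S_def)
qed

text \<open>A weak Stirling bound. Passing from \<open>n\<close> to \<open>n + 1\<close> costs
  \<open>n * (ln (n + 1) - ln n)\<close>, at most 1, which the extra subtracted 1 absorbs.\<close>

lemma ln_fact_lower_bound: "real n * ln (real n) - real n \<le> ln (fact n)"
proof (induction n)
  case (Suc n)
  show ?case
  proof (cases "n = 0")
    case False
    hence "ln (real n + 1) - ln (real n) \<le> 1 / real n"
      using ln_diff_le[of "real n + 1" "real n"] by simp
    hence "real n * (ln (real n + 1) - ln (real n)) \<le> 1"
      using False by (simp add: field_simps)
    moreover have "ln (fact (Suc n) :: real) = ln (real n + 1) + ln (fact n)"
      by (simp add: ln_mult add.commute)
    ultimately show ?thesis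
      using Suc by (simp add: algebra_simps)
  qed simp
qed simp

theorem theorem6:
  shows "R2_requires_Omega positive_quadrant (\<lambda>n. real n * ln (real n)) \<and>
         R2_requires_Omega reciprocal_diagonal (\<lambda>n. real n * ln (real n))"
proof -
  have bound: "1 / 2 * (real n * ln (real n)) \<le> real (depth t)"
    if t: "computes_R2 reciprocal_diagonal n t" and n: "9 \<le> n" for n t
  proof -
    \<comment> \<open>The threshold 9 comes from \<open>exp 1 \<le> 3\<close>: then
      \<open>ln n\<close> is at least 2, so the subtracted \<open>n\<close> in the factorial bound
      takes at most half of \<open>n * ln n\<close>. This gives the constant 1/2.\<close>
    have "exp 2 \<le> (9 :: real)"
      using power_mono[OF exp_le, of 2] by (simp flip: exp_of_nat_mult)
    also have "9 \<le> real n"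
      using n by simp
    finally have "2 \<le> ln (real n)"
      using n by (subst ln_ge_iff) auto
    hence "real n * 2 \<le> real n * ln (real n)"
      by (intro mult_left_mono) auto
    hence "1 / 2 * (real n * ln (real n)) \<le> ln (fact n)"
      using ln_fact_lower_bound[of n] by linarith
    also have "real (fact n) \<le> real (2 ^ depth t)"
      using fact_le_two_power_depth[OF t] n by (subst of_nat_le_iff) simp
    hence "ln (fact n :: real) \<le> ln (2 ^ depth t)"
      by simp
    also have "\<dots> = real (depth t) * ln 2"
      by (simp add: ln_realpow)
    also have "\<dots> \<le> real (depth t)"
      using ln_2_less_1 by (intro mult_left_le) auto
    finally show ?thesis .
  qed
  \<comment> \<open>A tree correct on the whole quadrant is correct on the curve, so the bound for
    the smaller domain gives both claims.\<close>
  have "reciprocal_diagonal \<subseteq> positive_quadrant"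
    by (auto simp: reciprocal_diagonal_def positive_quadrant_def)
  hence "computes_R2 positive_quadrant n t \<Longrightarrow> computes_R2 reciprocal_diagonal n t" for n t
    unfolding computes_R2_def by blast
  thus ?thesis
    unfolding R2_requires_Omega_def using bound
    by (intro conjI exI[of _ "1 / 2"] eventually_sequentiallyI[of 9]) auto
qed

end
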